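(* Let $H=[h_1,h_2,\dots]$ be a transcendental semigroup. Then $BU(H)\cap K(H)=\emptyset$.
   Context: A transcendental semigroup $H=[h_1,h_2,\dots]$ is the semigroup, under composition, generated by a (finite or countable) family $\{h_1,h_2,\dots\}$ of transcendental entire functions, i.e. the set of all finite compositions of the generators. The set $H$ is countable and infinite; let $(g_n)_{n\ge 1}$ be an enumeration of the elements of $H$ without repetition. The bungee set $BU(H)$ is the set of all $z\in\mathbb{C}$ for which there exist subsequences $(g_{m_k})$ and $(g_{n_k})$ of $(g_n)$, with $m_k,n_k\to\infty$ as $k\to\infty$, and a constant $R>0$ such that $|g_{m_k}(z)|<R$ for all $k$ and $|g_{n_k}(z)|\to\infty$ as $k\to\infty$. The filled Julia set $K(H)$ is the set of all $z\in\mathbb{C}$ such that every sequence in $H$ has a subsequence which is bounded at $z$ (i.e. every sequence $(f_n)$ of elements of $H$ has a subsequence $(f_{n_k})$ with $(f_{n_k}(z))_k$ bounded). *)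

theory Defs
  imports "HOL-Complex_Analysis.Complex_Analysis"
begin

definition transcendental_entire :: "(complex \<Rightarrow> complex) \<Rightarrow> bool" where
  "transcendental_entire f \<longleftrightarrow>
     f holomorphic_on UNIV \<and> \<not> (\<exists>p :: complex poly. f = poly p)"

inductive_set generated_semigroup :: "('a \<Rightarrow> 'a) set \<Rightarrow> ('a \<Rightarrow> 'a) set"
  for F :: "('a \<Rightarrow> 'a) set" where
  generator: "h \<in> F \<Longrightarrow> h \<in> generated_semigroup F"
| compose: "f \<in> generated_semigroup F \<Longrightarrow> g \<in> generated_semigroup F \<Longrightarrow>
            f \<circ> g \<in> generated_semigroup F"

definition transcendental_semigroup :: "(complex \<Rightarrow> complex) set \<Rightarrow> bool" where
  "transcendental_semigroup H \<longleftrightarrow>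
     (\<exists>F. F \<noteq> {} \<and> countable F \<and> (\<forall>h\<in>F. transcendental_entire h) \<and>
          H = generated_semigroup F)"

(* The bungee set of a semigroup is defined through an enumeration of its elements
   without repetition; the argument g is this enumeration, indexed from 0. *)
definition bungee_set :: "(nat \<Rightarrow> complex \<Rightarrow> complex) \<Rightarrow> complex set" where
  "bungee_set g =
     {z. \<exists>(m :: nat \<Rightarrow> nat) (n :: nat \<Rightarrow> nat) R :: real. R > 0 \<and> strict_mono m \<and> strict_mono n \<and>
           (\<forall>k. norm (g (m k) z) < R) \<and>
           filterlim (\<lambda>k. norm (g (n k) z)) at_top sequentially}"

definition filled_Julia_set :: "(complex \<Rightarrow> complex) set \<Rightarrow> complex set" where
  "filled_Julia_set H =
     {z. \<forall>f :: nat \<Rightarrow> complex \<Rightarrow> complex. (\<forall>n. f n \<in> H) \<longrightarrow>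
           (\<exists>r :: nat \<Rightarrow> nat. strict_mono r \<and> bounded (range (\<lambda>k. f (r k) z)))}"

end

theory Submission
  imports Defs
begin

text \<open>
  The two sets make contradictory demands along one sequence. A point of the bungee set comes with
  a subsequence of the enumeration along which its orbit escapes to infinity. This is a sequence in
  the semigroup, so at a point of the filled Julia set it has a further subsequence that is bounded.
  But every subsequence of a sequence tending to infinity tends to infinity as well.
\<close>

lemma norm_at_top_imp_subseq_unbounded:
  fixes x :: "nat \<Rightarrow> 'a::real_normed_vector"
  assumes "filterlim (\<lambda>k. norm (x k)) at_top sequentially" and "strict_mono (r :: nat \<Rightarrow> nat)"
  shows "\<not> bounded (range (\<lambda>k. x (r k)))"
proof
  assume "bounded (range (\<lambda>k. x (r k)))"
  then obtain B where B: "\<And>k. norm (x (r k)) \<le> B"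
    by (auto simp: bounded_iff)
  have "filterlim (\<lambda>k. norm (x (r k))) at_top sequentially"
    using filterlim_compose[OF assms(1) filterlim_subseq[OF assms(2)]] .
  then have "eventually (\<lambda>k. B < norm (x (r k))) sequentially"
    by (simp add: filterlim_at_top_dense)
  then obtain k where "B < norm (x (r k))"
    by (auto simp: eventually_sequentially)
  with B[of k] show False by simp
qed

theorem proposition4p18:
  fixes H :: "(complex \<Rightarrow> complex) set" and g :: "nat \<Rightarrow> complex \<Rightarrow> complex"
  assumes "transcendental_semigroup H"
    and "bij_betw g UNIV H"
  shows "bungee_set g \<inter> filled_Julia_set H = {}"
proof (rule equals0I)
  fix z assume z: "z \<in> bungee_set g \<inter> filled_Julia_set H"
  then obtain n where n: "filterlim (\<lambda>k. norm (g (n k) z)) at_top sequentially"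
    by (auto simp: bungee_set_def)
  have "\<forall>k. g (n k) \<in> H"
    using assms(2) by (auto simp: bij_betw_def)
  moreover have "\<forall>f. (\<forall>k. f k \<in> H) \<longrightarrow>
      (\<exists>r::nat \<Rightarrow> nat. strict_mono r \<and> bounded (range (\<lambda>k. f (r k) z)))"
    using z by (simp add: filled_Julia_set_def)
  ultimately obtain r :: "nat \<Rightarrow> nat"
    where "strict_mono r" "bounded (range (\<lambda>k. g (n (r k)) z))"
    by (auto dest: spec[where x = "\<lambda>k. g (n k)"])
  with norm_at_top_imp_subseq_unbounded[OF n] show False by blast
qed

end
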